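(* Let $n$ be an odd positive integer and let $(V,\mu)$ be an $n$-ary partially associative algebra over $\mathbb{K}$, i.e. $\mu\in C^n(V)$ with $\mu\bullet\mu=0$. For each $k$ let $\chi^k(V)\subset C^k(V)$ be the subspace of all $\varphi\in C^k(V)$ satisfying $$(\varphi\bullet\mu)\bullet\mu=0,\qquad (\mu\bullet\varphi)\bullet\mu=0,\qquad \mu\bullet(\varphi\bullet\mu)=0,$$ and let $\partial^k:\chi^k(V)\to C^{k+n-1}(V)$ be the linear map $$\partial^k\varphi=(-1)^{k-1}\mu\bullet\varphi-\varphi\bullet\mu .$$ Then: 1. the image of $\partial^k$ is included in $\chi^{k+n-1}(V)$; 2. $\partial^{k+n-1}\circ\partial^k=0$.
   Context: $\mathbb{K}$ is a field of characteristic $0$, $V$ is a $\mathbb{K}$-vector space, and $C^k(V)=\mathrm{Hom}_{\mathbb{K}}(V^{\otimes k},V)$ for any natural number $k$ (with $V^{\otimes 0}=\mathbb{K}$). For $f\in C^r(V)$ and $g\in C^s(V)$, the Gerstenhaber product $f\bullet g=f\bullet_{r,s}g\in C^{r+s-1}(V)$ is $$f\bullet g(X_1\otimes\cdots\otimes X_{r+s-1})=\sum_{j=1}^{r}(-1)^{(j-1)(s-1)}f\big(X_1\otimes\cdots\otimes X_{j-1}\otimes g(X_j\otimes\cdots\otimes X_{j+s-1})\otimes X_{j+s}\otimes\cdots\otimes X_{r+s-1}\big)$$ (an empty sum, hence $0$, if $r=0$). An $n$-ary partially associative algebra is a pair $(V,\mu)$ with $\mu\in C^n(V)$ and $\mu\bullet\mu=0$.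 *)

theory Defs
  imports Complex_Main
begin

(* C^k(V) = Hom(V^{(x)k}, V), given as k-multilinear maps by the universal property of the
   tensor power.  Arguments are lists of length k; the value on lists of any other length is
   normalised to 0, so that equality of cochains is equality of functions.  For k = 0 the only
   admissible list is [], so that C^0(V) = Hom(K, V) = V. *)
definition cochains ::
    "('k::field_char_0 \<Rightarrow> 'v::ab_group_add \<Rightarrow> 'v) \<Rightarrow> nat \<Rightarrow> ('v list \<Rightarrow> 'v) set" where
  "cochains scale k =
    {f. (\<forall>xs i. length xs = k \<and> i < k \<longrightarrow>
            Vector_Spaces.linear scale scale (\<lambda>x. f (xs[i := x])))
      \<and> (\<forall>xs. length xs \<noteq> k \<longrightarrow> f xs = 0)}"

(* The product f \<bullet>_{r,s} g of f in C^r(V) and g in C^s(V).  The exponent is an integer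
   because s - 1 = -1 for s = 0.  The truncated length r + s - 1 is wrong only for r = s = 0,
   where the sum is empty. *)
definition gerstenhaber ::
    "('k::field_char_0 \<Rightarrow> 'v::ab_group_add \<Rightarrow> 'v) \<Rightarrow> nat \<Rightarrow> nat
      \<Rightarrow> ('v list \<Rightarrow> 'v) \<Rightarrow> ('v list \<Rightarrow> 'v) \<Rightarrow> 'v list \<Rightarrow> 'v" where
  "gerstenhaber scale r s f g xs =
    (if length xs = r + s - 1 then
       (\<Sum>j = 1..r. scale ((-1) powi ((int j - 1) * (int s - 1)))
          (f (take (j - 1) xs @ [g (take s (drop (j - 1) xs))] @ drop (j - 1 + s) xs)))
     else 0)"

definition partially_associative ::
    "('k::field_char_0 \<Rightarrow> 'v::ab_group_add \<Rightarrow> 'v) \<Rightarrow> nat \<Rightarrow> ('v list \<Rightarrow> 'v) \<Rightarrow> bool" where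
  "partially_associative scale n \<mu> \<longleftrightarrow>
     \<mu> \<in> cochains scale n \<and> gerstenhaber scale n n \<mu> \<mu> = (\<lambda>_. 0)"

definition chi ::
    "('k::field_char_0 \<Rightarrow> 'v::ab_group_add \<Rightarrow> 'v) \<Rightarrow> nat \<Rightarrow> ('v list \<Rightarrow> 'v)
      \<Rightarrow> nat \<Rightarrow> ('v list \<Rightarrow> 'v) set" where
  "chi scale n \<mu> k =
    {\<phi> \<in> cochains scale k.
        gerstenhaber scale (k + n - 1) n (gerstenhaber scale k n \<phi> \<mu>) \<mu> = (\<lambda>_. 0)
      \<and> gerstenhaber scale (n + k - 1) n (gerstenhaber scale n k \<mu> \<phi>) \<mu> = (\<lambda>_. 0)
      \<and> gerstenhaber scale n (k + n - 1) \<mu> (gerstenhaber scale k n \<phi> \<mu>) = (\<lambda>_. 0)}"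

definition coboundary ::
    "('k::field_char_0 \<Rightarrow> 'v::ab_group_add \<Rightarrow> 'v) \<Rightarrow> nat \<Rightarrow> ('v list \<Rightarrow> 'v)
      \<Rightarrow> nat \<Rightarrow> ('v list \<Rightarrow> 'v) \<Rightarrow> 'v list \<Rightarrow> 'v" where
  "coboundary scale n \<mu> k \<phi> xs =
     scale ((-1) powi (int k - 1)) (gerstenhaber scale n k \<mu> \<phi> xs)
     - gerstenhaber scale k n \<phi> \<mu> xs"

end

(* The associator (f \<bullet> g) \<bullet> h - f \<bullet> (g \<bullet> h) only consists of the terms in which g and h are inserted
   into disjoint groups of arguments of f, so it is graded symmetric in g and h.  For \<mu> of even
   degree n - 1 with \<mu> \<bullet> \<mu> = 0 and \<phi> in \<chi>^k(V), this symmetry for the triple (\<mu>, \<mu>, \<phi>) leaves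
   \<mu> \<bullet> (\<mu> \<bullet> \<phi>) = 0.  With the three defining equations of \<chi>^k(V), every term of
   \<partial>(\<partial> \<phi>), and every term of the three equations for \<partial> \<phi>, vanishes by bilinearity. *)
theory Submission
  imports Defs
begin

section \<open>Signs and insertions into argument lists\<close>

lemma neg_one_powi_cong:
  assumes "even (a - b)"
  shows "(-1 :: 'a::field) powi a = (-1) powi b"
proof -
  have "(-1 :: 'a) powi a = (-1) powi ((a - b) + b)" by simp
  also have "\<dots> = (-1) powi (a - b) * (-1) powi b"
    by (rule power_int_add) simp
  also have "(-1 :: 'a) powi (a - b) = 1" using assms by simp
  finally show ?thesis by simp
qed

text \<open>One summand of the product without its sign and without the length check. Slots are
  counted from 0, whereas the sum in \<open>gerstenhaber_def\<close> starts at 1.\<close>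

definition insertion ::
    "nat \<Rightarrow> nat \<Rightarrow> ('v list \<Rightarrow> 'v) \<Rightarrow> ('v list \<Rightarrow> 'v) \<Rightarrow> 'v list \<Rightarrow> 'v" where
  "insertion j s f g xs = f (take j xs @ g (take s (drop j xs)) # drop (j + s) xs)"

(* The blocks consumed by g and h occupy the slots p and q + 1 of f. *)
definition double_insertion ::
    "nat \<Rightarrow> nat \<Rightarrow> ('v list \<Rightarrow> 'v) \<Rightarrow> nat \<Rightarrow> nat \<Rightarrow> ('v list \<Rightarrow> 'v) \<Rightarrow> ('v list \<Rightarrow> 'v) \<Rightarrow> 'v list \<Rightarrow> 'v"
  where
  "double_insertion p s g q t h f xs =
     f (take p xs @ g (take s (drop p xs)) # take (q - p) (drop (p + s) xs)
          @ h (take t (drop (q + s) xs)) # drop (q + s + t) xs)"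

text \<open>Here \<open>h\<close> acts to the left of \<open>g\<close>: its \<open>t\<close>
  arguments collapse to one entry, so slot \<open>Suc q\<close> of \<open>f\<close> reads from
  position \<open>q + t\<close> of \<open>xs\<close>. The right side is that of
  \<open>insertion_insertion_right\<close> with \<open>(g, s)\<close> and \<open>(h, t)\<close>
  exchanged, which is the source of the symmetry of the associator.\<close>

lemma insertion_insertion_left:
  assumes "p \<le> q" "q + t < length xs + 1"
  shows "insertion p t (insertion (Suc q) s f g) h xs = double_insertion p t h q s g f xs"
proof -
  have p: "p \<le> length xs" using assms by simp
  obtain d where q: "q = p + d" using assms(1) le_Suc_ex by blast
  show ?thesis
    using p assms(2) by (simp add: insertion_def double_insertion_def q min_def ac_simps Suc_diff_le)
qed

lemma insertion_insertion_right:
  assumes "p \<le> q" "q + s \<le> length xs"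
  shows "insertion (q + s) t (insertion p s f g) h xs = double_insertion p s g q t h f xs"
proof -
  obtain d where q: "q = p + d" using assms(1) le_Suc_ex by blast
  show ?thesis
    using assms(2)
    by (simp add: insertion_def double_insertion_def q min_def ac_simps drop_take)
qed

text \<open>Position \<open>i + m\<close> lies inside the block read by \<open>g\<close>, so
  \<open>h\<close> supplies argument \<open>m\<close> of \<open>g\<close> and the block grows to
  \<open>s + t - 1\<close> entries. These are the terms of f \<bullet> (g \<bullet> h).\<close>

lemma insertion_insertion_nested:
  assumes "m < s" "i + m \<le> length xs"
  shows "insertion (i + m) t (insertion i s f g) h xs
       = insertion i (s + t - 1) f (insertion m t g h) xs"
proof -
  obtain d where s: "s = Suc (m + d)" using assms(1) less_iff_Suc_add by auto
  show ?thesis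
    using assms(2)
    by (simp add: insertion_def s min_def ac_simps drop_take)
qed

text \<open>Reduces multilinearity of the product to that of its factors: an entry of
  \<open>xs\<close> reaches \<open>f\<close> in exactly one slot, through \<open>g\<close> if it
  lies in the block. Behind the block the index moves by 1 - s; the form \<open>Suc i - s\<close> is
  exact there, also for s = 0.\<close>

lemma insertion_list_update:
  assumes "j < r" "length xs = r + s - 1" "i < length xs"
  shows "insertion j s f g (xs[i := x]) =
    (if i < j then f ((take j xs @ g (take s (drop j xs)) # drop (j + s) xs)[i := x])
     else if i < j + s then
       f ((take j xs @ g (take s (drop j xs)) # drop (j + s) xs)
            [j := g ((take s (drop j xs))[i - j := x])])
     else f ((take j xs @ g (take s (drop j xs)) # drop (j + s) xs)[Suc i - s := x]))"
proof -
  consider "i < j" | "j \<le> i" "i < j + s" | "j + s \<le> i" by linarith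
  then show ?thesis
  proof cases
    case 1
    then show ?thesis using assms
      by (simp add: insertion_def list_update_append take_update_swap)
  next
    case 2
    then show ?thesis using assms
      by (simp add: insertion_def list_update_append drop_update_swap take_update_swap
          list_update_beyond min_le_iff_disj)
  next
    case 3
    then have "Suc i - s - j = Suc (i - (j + s))" and "\<not> Suc i - s < j" by linarith+
    then show ?thesis using assms 3
      by (simp add: insertion_def list_update_append drop_update_swap)
  qed
qed

section \<open>Multilinearity of cochains and bilinearity of the product\<close>

locale char0_vector_space = vector_space scale
  for scale :: "'k::field_char_0 \<Rightarrow> 'v::ab_group_add \<Rightarrow> 'v"
begin

lemma linear_iff_scale:
  "Vector_Spaces.linear scale scale F \<longleftrightarrow>
     (\<forall>x y. F (x + y) = F x + F y) \<and> (\<forall>c x. F (scale c x) = scale c (F x))"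
  unfolding Vector_Spaces.linear_iff using vector_space_axioms by simp

lemma linear_scale_diff:
  assumes "Vector_Spaces.linear scale scale F"
  shows "F (scale c x - y) = scale c (F x) - F y"
proof -
  have add: "F (a + b) = F a + F b" and sc: "F (scale e a) = scale e (F a)" for a b e
    using assms by (auto simp: linear_iff_scale)
  have "F (scale c x - y) + F y = scale c (F x)"
    by (simp flip: add sc)
  then show ?thesis by (simp add: eq_diff_eq)
qed

lemma linear_scale_sum:
  assumes "Vector_Spaces.linear scale scale F"
  shows "F (\<Sum>a\<in>A. scale (c a) (u a)) = (\<Sum>a\<in>A. scale (c a) (F (u a)))"
proof -
  have add: "F (a + b) = F a + F b" and sc: "F (scale e a) = scale e (F a)" for a b e
    using assms by (auto simp: linear_iff_scale)
  have "F 0 = 0" using sc[of 0 0] by simp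
  then show ?thesis
    by (induction A rule: infinite_finite_induct) (simp_all add: add sc)
qed

lemma linear_slot:
  assumes "f \<in> cochains scale r" "length as + length bs + 1 = r"
  shows "Vector_Spaces.linear scale scale (\<lambda>x. f (as @ x # bs))"
proof -
  \<comment> \<open>The entry 0 is a placeholder: \<open>cochains\<close> expresses linearity by
    list update, which overwrites it.\<close>
  have "Vector_Spaces.linear scale scale (\<lambda>x. f ((as @ 0 # bs)[length as := x]))"
    using assms unfolding cochains_def
    by (simp only: mem_Collect_eq) (erule conjE, erule allE[of _ "as @ 0 # bs"], erule allE[of _ "length as"], simp)
  then show ?thesis by simp
qed

lemma gerstenhaber_insertion:
  assumes "length xs = r + s - 1"
  shows "gerstenhaber scale r s f g xs =
    (\<Sum>j<r. scale ((-1) powi (int j * (int s - 1))) (insertion j s f g xs))"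
  unfolding gerstenhaber_def insertion_def
  using assms
  by (simp, intro sum.reindex_bij_witness[of _ Suc "\<lambda>j. j - 1"]) (auto simp: of_nat_diff)

lemma gerstenhaber_wrong_length:
  "length xs \<noteq> r + s - 1 \<Longrightarrow> gerstenhaber scale r s f g xs = 0"
  by (simp add: gerstenhaber_def)

lemma gerstenhaber_zero_left: "gerstenhaber scale r s (\<lambda>_. 0) g = (\<lambda>_. 0)"
  by (rule ext) (simp add: gerstenhaber_def)

text \<open>The combination of \<open>f\<close> and \<open>f'\<close> has the shape of
  \<open>coboundary\<close>, so this one rule carries additivity and homogeneity together.\<close>

lemma gerstenhaber_scale_diff_left:
  "gerstenhaber scale r s (\<lambda>xs. scale c (f xs) - f' xs) g
     = (\<lambda>xs. scale c (gerstenhaber scale r s f g xs) - gerstenhaber scale r s f' g xs)"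
  by (rule ext)
    (simp add: gerstenhaber_def scale_right_diff_distrib sum_subtractf scale_sum_right mult.commute)

lemma linear_insertion_slot:
  assumes "f \<in> cochains scale r" "j < r" "length xs = r + s - 1"
  shows "Vector_Spaces.linear scale scale (\<lambda>x. f (take j xs @ x # drop (j + s) xs))"
  using assms by (intro linear_slot) auto

text \<open>In each summand the value of the right factor is a single entry of the argument list of
  \<open>f\<close>, so multilinearity of \<open>f\<close> gives linearity in that factor.\<close>

lemma gerstenhaber_scale_diff_right:
  assumes "f \<in> cochains scale r"
  shows "gerstenhaber scale r s f (\<lambda>xs. scale c (g xs) - g' xs)
     = (\<lambda>xs. scale c (gerstenhaber scale r s f g xs) - gerstenhaber scale r s f g' xs)"
proof
  fix xs :: "'v list"
  show "gerstenhaber scale r s f (\<lambda>xs. scale c (g xs) - g' xs) xs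
     = scale c (gerstenhaber scale r s f g xs) - gerstenhaber scale r s f g' xs"
  proof (cases "length xs = r + s - 1")
    case True
    have "insertion j s f (\<lambda>xs. scale c (g xs) - g' xs) xs
        = scale c (insertion j s f g xs) - insertion j s f g' xs" if "j < r" for j
      unfolding insertion_def
      by (rule linear_scale_diff[OF linear_insertion_slot[OF assms that True]])
    then show ?thesis
      by (simp add: gerstenhaber_insertion True scale_right_diff_distrib sum_subtractf
          scale_sum_right mult.commute)
  qed (simp add: gerstenhaber_wrong_length)
qed

lemma gerstenhaber_zero_right:
  assumes "f \<in> cochains scale r"
  shows "gerstenhaber scale r s f (\<lambda>_. 0) = (\<lambda>_. 0)"
  \<comment> \<open>With c = 1 and two equal functions the right side is a difference of equal
    terms.\<close>
  using gerstenhaber_scale_diff_right[OF assms, of s 1 "\<lambda>_. 0" "\<lambda>_. 0"] by simp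

lemma scale_diff_in_cochains:
  assumes "f \<in> cochains scale r" "g \<in> cochains scale r"
  shows "(\<lambda>xs. scale c (f xs) - g xs) \<in> cochains scale r"
  using assms unfolding cochains_def linear_iff_scale
  by (auto simp: algebra_simps)

lemma linear_insertion:
  assumes "f \<in> cochains scale r" "g \<in> cochains scale s"
    and "j < r" "length xs = r + s - 1" "i < length xs"
  shows "Vector_Spaces.linear scale scale (\<lambda>x. insertion j s f g (xs[i := x]))"
proof -
  define L where "L = take j xs @ g (take s (drop j xs)) # drop (j + s) xs"
  have len: "length L = r" using assms by (simp add: L_def)
  have f: "Vector_Spaces.linear scale scale (\<lambda>x. f (L[m := x]))" if "m < r" for m
    using assms(1) len that by (simp add: cochains_def)
  have g: "Vector_Spaces.linear scale scale (\<lambda>x. g ((take s (drop j xs))[m := x]))" if "m < s" for m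
    using assms that by (simp add: cochains_def)
  consider "i < j" | "j \<le> i" "i < j + s" | "j + s \<le> i" by linarith
  then show ?thesis
  proof cases
    case 1
    then show ?thesis
      using f[of i] assms by (simp add: insertion_list_update flip: L_def)
  next
    case 2
    \<comment> \<open>The changed entry enters \<open>f\<close> through \<open>g\<close>, so the map
      is a composite of two linear maps.\<close>
    then show ?thesis
      using f[of j] g[of "i - j"] assms
      by (simp add: insertion_list_update linear_iff_scale flip: L_def)
  next
    case 3
    then show ?thesis
      using f[of "Suc i - s"] assms by (simp add: insertion_list_update flip: L_def)
  qed
qed

lemma gerstenhaber_in_cochains:
  assumes "f \<in> cochains scale r" "g \<in> cochains scale s"
  shows "gerstenhaber scale r s f g \<in> cochains scale (r + s - 1)"
proof -
  have "Vector_Spaces.linear scale scale (\<lambda>x. gerstenhaber scale r s f g (xs[i := x]))"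
    if "length xs = r + s - 1" "i < r + s - 1" for xs :: "'v list" and i
  proof -
    have "insertion j s f g (xs[i := x + y])
        = insertion j s f g (xs[i := x]) + insertion j s f g (xs[i := y])"
      and "insertion j s f g (xs[i := scale c x]) = scale c (insertion j s f g (xs[i := x]))"
      if "j < r" for j x y c
      using linear_insertion[OF assms that, of xs i] \<open>length xs = r + s - 1\<close> \<open>i < r + s - 1\<close>
      by (auto simp: linear_iff_scale)
    then show ?thesis
      using that
      by (simp add: linear_iff_scale gerstenhaber_insertion scale_right_distrib sum.distrib
          scale_sum_right mult.commute)
  qed
  then show ?thesis
    unfolding cochains_def by (simp add: gerstenhaber_wrong_length)
qed

section \<open>Iterated products, the associator and its graded symmetry\<close>

lemma gerstenhaber_gerstenhaber_left:
  assumes "0 < r" "0 < s + t" "length xs + 2 = r + s + t"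
  shows "gerstenhaber scale (r + s - 1) t (gerstenhaber scale r s f g) h xs
    = (\<Sum>(i, j) \<in> {..<r} \<times> {..<r + s - 1}.
         scale ((-1) powi (int i * (int s - 1) + int j * (int t - 1)))
           (insertion j t (insertion i s f g) h xs))"
proof -
  \<comment> \<open>After \<open>h\<close> is inserted, r + s - 1 entries remain, so the inner
    product is given by its sum and not by the default value 0.\<close>
  have "insertion j t (gerstenhaber scale r s f g) h xs
      = (\<Sum>i<r. scale ((-1) powi (int i * (int s - 1))) (insertion j t (insertion i s f g) h xs))"
    if "j < r + s - 1" for j
    using that assms
    by (simp add: insertion_def[of j] gerstenhaber_insertion)
  then have "gerstenhaber scale (r + s - 1) t (gerstenhaber scale r s f g) h xs
    = (\<Sum>j<r + s - 1. \<Sum>i<r. scale ((-1) powi (int i * (int s - 1) + int j * (int t - 1)))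
           (insertion j t (insertion i s f g) h xs))"
    using assms
    by (simp add: gerstenhaber_insertion scale_sum_right power_int_add mult.commute)
  also have "\<dots> = (\<Sum>i<r. \<Sum>j<r + s - 1. scale ((-1) powi (int i * (int s - 1) + int j * (int t - 1)))
           (insertion j t (insertion i s f g) h xs))"
    by (rule sum.swap)
  finally show ?thesis by (simp add: sum.cartesian_product)
qed

lemma gerstenhaber_gerstenhaber_right:
  assumes "f \<in> cochains scale r" "0 < r" "0 < s + t" "length xs + 2 = r + s + t"
  shows "gerstenhaber scale r (s + t - 1) f (gerstenhaber scale s t g h) xs
    = (\<Sum>(i, j) \<in> {(i, j). i < r \<and> i \<le> j \<and> j < i + s}.
         scale ((-1) powi (int i * (int s - 1) + int j * (int t - 1)))
           (insertion j t (insertion i s f g) h xs))"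
proof -
  have len: "length xs = r + (s + t - 1) - 1" using assms by linarith
  \<comment> \<open>Positivity of s + t makes the truncated subtraction exact, so the sign has the
    true degree.\<close>
  have deg: "int (s + t - 1) = int s + int t - 1" using assms(3) by linarith
  have "insertion i (s + t - 1) f (gerstenhaber scale s t g h) xs
      = (\<Sum>m<s. scale ((-1) powi (int m * (int t - 1)))
          (insertion (i + m) t (insertion i s f g) h xs))"
    if "i < r" for i
  proof -
    have *: "length (take (s + t - 1) (drop i xs)) = s + t - 1"
      using assms that by simp
    have "insertion i (s + t - 1) f (gerstenhaber scale s t g h) xs
      = (\<Sum>m<s. scale ((-1) powi (int m * (int t - 1)))
          (insertion i (s + t - 1) f (insertion m t g h) xs))"
      unfolding insertion_def[of i] gerstenhaber_insertion[OF *]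
      by (rule linear_scale_sum[OF linear_insertion_slot[OF assms(1) that len]])
    also have "\<dots> = (\<Sum>m<s. scale ((-1) powi (int m * (int t - 1)))
          (insertion (i + m) t (insertion i s f g) h xs))"
      using assms that by (intro sum.cong) (auto simp: insertion_insertion_nested)
    finally show ?thesis .
  qed
  then have "gerstenhaber scale r (s + t - 1) f (gerstenhaber scale s t g h) xs
    = (\<Sum>i<r. \<Sum>m<s. scale ((-1) powi (int i * (int (s + t - 1) - 1) + int m * (int t - 1)))
          (insertion (i + m) t (insertion i s f g) h xs))"
    using len by (simp add: gerstenhaber_insertion scale_sum_right power_int_add mult.commute)
  also have "\<dots> = (\<Sum>(i, m) \<in> {..<r} \<times> {..<s}.
       scale ((-1) powi (int i * (int (s + t - 1) - 1) + int m * (int t - 1)))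
          (insertion (i + m) t (insertion i s f g) h xs))"
    by (rule sum.cartesian_product)
  \<comment> \<open>With j = i + m, the exponent i (s + t - 2) + m (t - 1) equals i (s - 1) + j (t -
    1), so the signs match those of \<open>gerstenhaber_gerstenhaber_left\<close>.\<close>
  also have "\<dots> = (\<Sum>(i, j) \<in> {(i, j). i < r \<and> i \<le> j \<and> j < i + s}.
         scale ((-1) powi (int i * (int s - 1) + int j * (int t - 1)))
           (insertion j t (insertion i s f g) h xs))"
    unfolding deg
    by (intro sum.reindex_bij_witness[of _ "\<lambda>(i, j). (i, j - i)" "\<lambda>(i, m). (i, i + m)"])
      (auto simp: of_nat_diff algebra_simps)
  finally show ?thesis .
qed

text \<open>Let \<open>g\<close> sit in slot i of \<open>f\<close> and \<open>h\<close> in slot j of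
  the composite. The position of \<open>h\<close> relative to the block of \<open>g\<close> splits
  the index rectangle into left (\<open>A\<close>), inside (\<open>B\<close>) and right
  (\<open>C\<close>). The part \<open>B\<close> is f \<bullet> (g \<bullet> h) with the same signs
  and cancels.\<close>

lemma gerstenhaber_associator:
  fixes f g h :: "'v list \<Rightarrow> 'v"
  assumes "f \<in> cochains scale r" "0 < r" "0 < s + t" "length xs + 2 = r + s + t"
  shows "gerstenhaber scale (r + s - 1) t (gerstenhaber scale r s f g) h xs
       - gerstenhaber scale r (s + t - 1) f (gerstenhaber scale s t g h) xs
    = (\<Sum>(p, q) \<in> {(p, q). p \<le> q \<and> Suc q < r}.
         scale ((-1) powi (int p * (int t - 1) + (int q + 1) * (int s - 1)))
           (double_insertion p t h q s g f xs))
    + (\<Sum>(p, q) \<in> {(p, q). p \<le> q \<and> Suc q < r}.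
         scale ((-1) powi (int p * (int s - 1) + (int q + int s) * (int t - 1)))
           (double_insertion p s g q t h f xs))"
proof -
  define T where "T = (\<lambda>(i, j). scale ((-1) powi (int i * (int s - 1) + int j * (int t - 1)))
           (insertion j t (insertion i s f g) h xs))"
  define A where "A = {(i, j). i < r \<and> j < i}"
  define B where "B = {(i, j). i < r \<and> i \<le> j \<and> j < i + s}"
  define C where "C = {(i, j). i + s \<le> j \<and> j < r + s - 1}"
  \<comment> \<open>The bounds absent from the three sets follow: i < r in \<open>C\<close> from i +
    s \<le> j < r + s - 1, and j < r + s - 1 in \<open>A\<close> and \<open>B\<close> from i <
    r.\<close>
  have part: "{..<r} \<times> {..<r + s - 1} = A \<union> B \<union> C"
    by (auto simp: A_def B_def C_def)
  then have fin: "finite (A \<union> B \<union> C)" by (metis finite_SigmaI finite_lessThan)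
  have "sum T ({..<r} \<times> {..<r + s - 1}) = sum T (A \<union> B) + sum T C"
    unfolding part using fin by (intro sum.union_disjoint) (auto simp: A_def B_def C_def)
  also have "sum T (A \<union> B) = sum T A + sum T B"
    using fin by (intro sum.union_disjoint) (auto simp: A_def B_def)
  finally have split: "sum T ({..<r} \<times> {..<r + s - 1}) - sum T B = sum T A + sum T C"
    by simp
  have "sum T A = (\<Sum>(p, q) \<in> {(p, q). p \<le> q \<and> Suc q < r}.
         scale ((-1) powi (int p * (int t - 1) + (int q + 1) * (int s - 1)))
           (double_insertion p t h q s g f xs))"
    using assms unfolding A_def T_def
    by (intro sum.reindex_bij_witness[of _ "\<lambda>(p, q). (Suc q, p)" "\<lambda>(i, j). (j, i - 1)"])
      (auto simp: insertion_insertion_left[symmetric] of_nat_diff algebra_simps)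
  moreover have "sum T C = (\<Sum>(p, q) \<in> {(p, q). p \<le> q \<and> Suc q < r}.
         scale ((-1) powi (int p * (int s - 1) + (int q + int s) * (int t - 1)))
           (double_insertion p s g q t h f xs))"
    using assms unfolding C_def T_def
    by (intro sum.reindex_bij_witness[of _ "\<lambda>(p, q). (p, q + s)" "\<lambda>(i, j). (i, j - s)"])
      (auto simp: insertion_insertion_right[symmetric] of_nat_diff algebra_simps)
  ultimately show ?thesis
    using split
    unfolding gerstenhaber_gerstenhaber_left[OF assms(2-4)] gerstenhaber_gerstenhaber_right[OF assms]
      T_def[symmetric] B_def[symmetric]
    by (simp only:)
qed

text \<open>Exchanging \<open>(g, s)\<close> with \<open>(h, t)\<close> swaps the two sums in
  \<open>gerstenhaber_associator\<close>; only the comparison of signs remains.\<close>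

lemma gerstenhaber_pre_Lie:
  fixes f g h :: "'v list \<Rightarrow> 'v"
  assumes "f \<in> cochains scale r" "0 < r" "0 < s + t"
  shows "gerstenhaber scale (r + s - 1) t (gerstenhaber scale r s f g) h xs
       - gerstenhaber scale r (s + t - 1) f (gerstenhaber scale s t g h) xs
    = scale ((-1) powi ((int s - 1) * (int t - 1)))
        (gerstenhaber scale (r + t - 1) s (gerstenhaber scale r t f h) g xs
         - gerstenhaber scale r (t + s - 1) f (gerstenhaber scale t s h g) xs)"
proof (cases "length xs + 2 = r + s + t")
  case True
  have *: "0 < t + s" "length xs + 2 = r + t + s" using True assms by auto
  \<comment> \<open>The exponents of the two sides differ by the even number 2 (s - 1) (1 - t); in
    the second identity they coincide.\<close>
  have 1: "(-1 :: 'k) powi (int p * (int t - 1) + (int q + 1) * (int s - 1))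
     = (-1) powi ((int s - 1) * (int t - 1)) * (-1) powi (int p * (int t - 1) + (int q + int t) * (int s - 1))"
    for p q
    unfolding power_int_add[symmetric, of "-1 :: 'k", simplified]
    by (intro neg_one_powi_cong) (simp add: algebra_simps)
  have 2: "(-1 :: 'k) powi (int p * (int s - 1) + (int q + int s) * (int t - 1))
     = (-1) powi ((int s - 1) * (int t - 1)) * (-1) powi (int p * (int s - 1) + (int q + 1) * (int t - 1))"
    for p q
    unfolding power_int_add[symmetric, of "-1 :: 'k", simplified]
    by (intro neg_one_powi_cong) (simp add: algebra_simps)
  show ?thesis
    unfolding gerstenhaber_associator[OF assms True] gerstenhaber_associator[OF assms(1,2) *] 1 2
    by (simp add: scale_right_distrib scale_sum_right split_def add.commute)
next
  case False
  \<comment> \<open>By the positivity assumptions all four truncated arities equal r + s + t - 2, so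
    on any other length every term is the default 0.\<close>
  then have "length xs \<noteq> r + s - 1 + t - 1" "length xs \<noteq> r + (s + t - 1) - 1"
    "length xs \<noteq> r + t - 1 + s - 1" "length xs \<noteq> r + (t + s - 1) - 1"
    using assms(2,3) by linarith+
  then show ?thesis
    by (simp only: gerstenhaber_wrong_length not_False_eq_True diff_self scale_zero_right)
qed

section \<open>The spaces \<open>chi\<close> and the coboundary\<close>

lemma chi_mu_mu:
  assumes "odd n" "partially_associative scale n \<mu>" "\<phi> \<in> chi scale n \<mu> k"
  shows "gerstenhaber scale n (n + k - 1) \<mu> (gerstenhaber scale n k \<mu> \<phi>) = (\<lambda>_. 0)"
proof
  fix xs :: "'v list"
  have \<mu>: "\<mu> \<in> cochains scale n" "gerstenhaber scale n n \<mu> \<mu> = (\<lambda>_. 0)"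
    using assms(2) by (auto simp: partially_associative_def)
  have n: "0 < n" "0 < n + k" using assms(1) by (auto simp: odd_pos)
  have "gerstenhaber scale (n + k - 1) n (gerstenhaber scale n k \<mu> \<phi>) \<mu> = (\<lambda>_. 0)"
    and "gerstenhaber scale n (k + n - 1) \<mu> (gerstenhaber scale k n \<phi> \<mu>) = (\<lambda>_. 0)"
    using assms(3) by (auto simp: chi_def)
  \<comment> \<open>In the symmetry for (\<mu>, \<mu>, \<phi>), the term (\<mu> \<bullet> \<mu>)
    \<bullet> \<phi> vanishes by partial associativity, and both terms of the exchanged associator
    by the second and third equations of \<open>chi\<close>.\<close>
  then show "gerstenhaber scale n (n + k - 1) \<mu> (gerstenhaber scale n k \<mu> \<phi>) xs = 0"
    using gerstenhaber_pre_Lie[OF \<mu>(1) n, where g = \<mu> and h = \<phi> and xs = xs]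
    by (simp add: \<mu>(2) gerstenhaber_zero_left)
qed

theorem coboundary_in_chi_and_square_zero:
  assumes "odd n" "partially_associative scale n \<mu>" "\<phi> \<in> chi scale n \<mu> k"
  shows "coboundary scale n \<mu> k \<phi> \<in> chi scale n \<mu> (k + n - 1)"
    and "coboundary scale n \<mu> (k + n - 1) (coboundary scale n \<mu> k \<phi>) = (\<lambda>_. 0)"
proof -
  have \<mu>: "\<mu> \<in> cochains scale n"
    using assms(2) by (auto simp: partially_associative_def)
  have \<phi>: "\<phi> \<in> cochains scale k"
    and z1: "gerstenhaber scale (k + n - 1) n (gerstenhaber scale k n \<phi> \<mu>) \<mu> = (\<lambda>_. 0)"
    and z2: "gerstenhaber scale (k + n - 1) n (gerstenhaber scale n k \<mu> \<phi>) \<mu> = (\<lambda>_. 0)"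
    and z3: "gerstenhaber scale n (k + n - 1) \<mu> (gerstenhaber scale k n \<phi> \<mu>) = (\<lambda>_. 0)"
    using assms(3) by (auto simp: chi_def add.commute)
  have z4: "gerstenhaber scale n (k + n - 1) \<mu> (gerstenhaber scale n k \<mu> \<phi>) = (\<lambda>_. 0)"
    using chi_mu_mu[OF assms] by (simp add: add.commute)
  define \<psi> where "\<psi> = coboundary scale n \<mu> k \<phi>"
  have \<psi>: "\<psi> = (\<lambda>xs. scale ((-1) powi (int k - 1)) (gerstenhaber scale n k \<mu> \<phi> xs)
                 - gerstenhaber scale k n \<phi> \<mu> xs)"
    by (rule ext) (simp add: \<psi>_def coboundary_def)
  \<comment> \<open>The vanishing of \<psi> \<bullet> \<mu> and \<mu> \<bullet> \<psi> settles both
    claims: each equation of \<open>chi\<close> for \<psi> has one of them as inner product, and the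
    coboundary of \<psi> is a linear combination of the two.\<close>
  have right: "gerstenhaber scale (k + n - 1) n \<psi> \<mu> = (\<lambda>_. 0)"
    unfolding \<psi> gerstenhaber_scale_diff_left z1 z2 by simp
  have left: "gerstenhaber scale n (k + n - 1) \<mu> \<psi> = (\<lambda>_. 0)"
    unfolding \<psi> gerstenhaber_scale_diff_right[OF \<mu>] z3 z4 by simp
  have "\<psi> \<in> cochains scale (k + n - 1)"
    unfolding \<psi>
    using gerstenhaber_in_cochains[OF \<mu> \<phi>] gerstenhaber_in_cochains[OF \<phi> \<mu>]
    by (intro scale_diff_in_cochains) (simp_all add: add.commute)
  then show "coboundary scale n \<mu> k \<phi> \<in> chi scale n \<mu> (k + n - 1)"
    unfolding \<psi>_def[symmetric]
    unfolding chi_def mem_Collect_eq right left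
    by (simp add: gerstenhaber_zero_left gerstenhaber_zero_right[OF \<mu>])
  show "coboundary scale n \<mu> (k + n - 1) (coboundary scale n \<mu> k \<phi>) = (\<lambda>_. 0)"
    unfolding \<psi>_def[symmetric] unfolding coboundary_def right left by simp
qed

end

theorem theorem2:
  fixes scale :: "'k::field_char_0 \<Rightarrow> 'v::ab_group_add \<Rightarrow> 'v"
    and n :: nat and \<mu> :: "'v list \<Rightarrow> 'v" and k :: nat
  assumes "vector_space scale"
    and "odd n"
    and "partially_associative scale n \<mu>"
  shows "coboundary scale n \<mu> k ` chi scale n \<mu> k \<subseteq> chi scale n \<mu> (k + n - 1) \<and>
         (\<forall>\<phi> \<in> chi scale n \<mu> k.
            coboundary scale n \<mu> (k + n - 1) (coboundary scale n \<mu> k \<phi>) = (\<lambda>_. 0))"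
proof -
  interpret char0_vector_space scale
    using assms(1) by (simp add: char0_vector_space_def)
  show ?thesis
    using coboundary_in_chi_and_square_zero[OF assms(2,3)] by blast
qed

end
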